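(* Fix $\lambda>0$. For each integer $n>\lambda$ let $p=\lambda/n$, $p_i=p(1-p)^{i-1}$ for $1\le i\le n$, and $p_0=(1-p)^n$ (so $\sum_{i=0}^n p_i=1$). Draw coupons independently one after another, each being of type $i$ with probability $p_i$, $0\le i\le n$, and let $D=D^{(n)}$ be the number of draws (including draws of type $0$) until every one of the types $1,\dots,n$ has been drawn at least once. Let $$D'=\frac{D-\frac{e^{\lambda}}{\lambda}\, n(\log n-\log\log n)}{n}.$$ Then, as $n\to\infty$, $$D'\ \xrightarrow{\ \mathcal D\ }\ \mathrm{Gumbel}\left(-\frac{e^{\lambda}}{\lambda}\log\lambda,\ \frac{e^{\lambda}}{\lambda}\right),$$ where $\xrightarrow{\mathcal D}$ denotes convergence in distribution. Moreover, denoting by $F_{D'}$ the distribution function of $D'$, for each fixed $d'\in\mathbb R$, as $n\to\infty$, $$F_{D'}(d')=\exp\left(-\exp\left(-\frac{d'-\left(-\frac{e^{\lambda}}{\lambda}\log\lambda\right)}{e^{\lambda}/\lambda}\right)\right)+O\left(\frac{\log\log n}{\log n}\right).$$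
   Context: $\log$ is the natural logarithm. For $\mu\in\mathbb R$, $\beta>0$, $\mathrm{Gumbel}(\mu,\beta)$ is the probability law on $\mathbb R$ with distribution function $F(x)=\exp\left(-e^{-(x-\mu)/\beta}\right)$. The constant implied in the $O$-term may depend on $\lambda$ and $d'$. ($D$ models the number of packets needed by the victim of a single-attacker DoS attack at distance $n$ to reconstruct the attack path under edge-sampling with marking probability $p=\lambda/n$; type $0$ corresponds to an unmarked packet.) *)

theory Defs
  imports "HOL-Probability.Probability" "HOL-Library.Landau_Symbols" "HOL-Real_Asymp.Real_Asymp"
begin

definition gumbel_cdf :: "real \<Rightarrow> real \<Rightarrow> real \<Rightarrow> real" where
  "gumbel_cdf \<mu> \<beta> x = exp (- exp (- ((x - \<mu>) / \<beta>)))"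

definition gumbel :: "real \<Rightarrow> real \<Rightarrow> real measure" where
  "gumbel \<mu> \<beta> = interval_measure (gumbel_cdf \<mu> \<beta>)"

(* For \<beta> > 0 this is indeed the probability law with distribution function gumbel_cdf. *)
lemma
  assumes "\<beta> > 0"
  shows real_distribution_gumbel: "real_distribution (gumbel \<mu> \<beta>)"
    and cdf_gumbel: "cdf (gumbel \<mu> \<beta>) = gumbel_cdf \<mu> \<beta>"
proof -
  have mono: "gumbel_cdf \<mu> \<beta> x \<le> gumbel_cdf \<mu> \<beta> y" if "x \<le> y" for x y
    using that assms by (simp add: gumbel_cdf_def divide_right_mono)
  have cont: "continuous (at_right x) (gumbel_cdf \<mu> \<beta>)" for x
    unfolding gumbel_cdf_def using assms by (intro continuous_intros) auto
  have bot: "(gumbel_cdf \<mu> \<beta> \<longlongrightarrow> 0) at_bot"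
    unfolding gumbel_cdf_def using assms by real_asymp
  have top: "(gumbel_cdf \<mu> \<beta> \<longlongrightarrow> 1) at_top"
    unfolding gumbel_cdf_def using assms by real_asymp
  show "real_distribution (gumbel \<mu> \<beta>)"
    unfolding gumbel_def by (rule real_distribution_interval_measure[OF mono cont bot top])
  show "cdf (gumbel \<mu> \<beta>) = gumbel_cdf \<mu> \<beta>"
    unfolding gumbel_def by (rule cdf_interval_measure[OF mono cont bot])
qed

(* The probability of type i, for 0 \<le> i \<le> n; the formula is not meant for i > n. *)
definition coupon_prob :: "real \<Rightarrow> nat \<Rightarrow> nat \<Rightarrow> real" where
  "coupon_prob lam n i =
     (let p = lam / real n in if i = 0 then (1 - p) ^ n else p * (1 - p) ^ (i - 1))"

(* X k is the type of the (k+1)-st draw, so {..<m} indexes the first m draws.  Type 0 is drawn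
   and counted but not collected.  On the (null) event that some type never
   appears the value is Inf {} in nat, a fixed junk value. *)
definition collect_time :: "nat \<Rightarrow> (nat \<Rightarrow> 'a \<Rightarrow> nat) \<Rightarrow> 'a \<Rightarrow> nat" where
  "collect_time n X \<omega> = Inf {m. \<forall>i\<in>{1..n}. \<exists>k<m. X k \<omega> = i}"

definition norm_collect_time :: "real \<Rightarrow> nat \<Rightarrow> (nat \<Rightarrow> 'a \<Rightarrow> nat) \<Rightarrow> 'a \<Rightarrow> real" where
  "norm_collect_time lam n X \<omega> =
     (real (collect_time n X \<omega>) - exp lam / lam * real n * (ln (real n) - ln (ln (real n)))) / real n"

end

(* With f m the probability that the first m draws contain all types 1, ..., n, inclusion-exclusion
   makes the Poisson(t) average of f equal to the product of 1 - exp (-t * p_i).  As f is monotone,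
   Chebyshev's inequality for the Poisson law gives
     P (t1) - t1 / (m - t1)^2 <= f m <= P (t2) + t2 / (t2 - m)^2   for t1 < m < t2,
   P (t) being that product; t1 and t2 are taken at distance of order n^(3/4) from m.  The p_i are
   geometric with smallest term p_n, so with K = t * p_n the product is about exp (-S), where S is
   the sum of exp (-K * r^j) over j < n and r = 1 / (1 - lam / n).  For
   K = ln n - ln (ln n) + c + O (n^(-1/4)) explicit bounds on S give
   S = exp (-c) / lam + O (ln (ln n) / ln n). *)

theory Submission
  imports Defs
begin

section \<open>Poisson averages of a monotone sequence\<close>

definition poisson_weight :: "real \<Rightarrow> nat \<Rightarrow> real" where
  "poisson_weight t k = exp (-t) * t ^ k / fact k"

lemma poisson_weight_nonneg: "t \<ge> 0 \<Longrightarrow> poisson_weight t k \<ge> 0"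
  by (simp add: poisson_weight_def)

text \<open>This generating function is the exponential series at \<open>t * x\<close>. It gives the
  normalisation at \<open>x = 1\<close>, and it later averages the powers
  \<open>(1 - sum p S) ^ m\<close> of inclusion-exclusion.\<close>

lemma poisson_weight_power_sums:
  "(\<lambda>k. poisson_weight t k * x ^ k) sums exp (- (t * (1 - x)))"
proof -
  have "(\<lambda>k. exp (-t) * ((t * x) ^ k /\<^sub>R fact k)) sums (exp (-t) * exp (t * x))"
    by (intro sums_mult exp_converges)
  thus ?thesis
    by (simp add: poisson_weight_def divide_inverse power_mult_distrib mult_ac
        flip: exp_add) (simp add: algebra_simps)
qed

lemma poisson_weight_sums: "poisson_weight t sums 1"
  using poisson_weight_power_sums[of t 1] by simp

text \<open>\<open>(k + 1) * poisson_weight t (k + 1) = t * poisson_weight t k\<close>, so shifting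
  the index reduces the mean to the total mass; the summand at 0 vanishes. The second moment reduces
  to the mean in the same way.\<close>

lemma poisson_weight_mean: "(\<lambda>k. poisson_weight t k * real k) sums t"
proof -
  have "(\<lambda>k. poisson_weight t (Suc k) * real (Suc k)) = (\<lambda>k. t * poisson_weight t k)"
    by (auto simp: poisson_weight_def field_simps simp del: of_nat_Suc)
  hence "(\<lambda>k. poisson_weight t (Suc k) * real (Suc k)) sums t"
    using sums_mult[OF poisson_weight_sums[of t], of t] by simp
  from sums_Suc[OF this] show ?thesis by simp
qed

lemma poisson_weight_second_moment:
  "(\<lambda>k. poisson_weight t k * (real k)\<^sup>2) sums (t\<^sup>2 + t)"
proof -
  have "(\<lambda>k. poisson_weight t (Suc k) * (real (Suc k))\<^sup>2)
          = (\<lambda>k. t * (poisson_weight t k * real k + poisson_weight t k))"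
  proof
    fix k
    have "poisson_weight t (Suc k) * real (Suc k) = t * poisson_weight t k"
      by (simp add: poisson_weight_def field_simps del: of_nat_Suc)
    hence "poisson_weight t (Suc k) * real (Suc k) * real (Suc k)
             = t * poisson_weight t k * real (Suc k)" by simp
    thus "poisson_weight t (Suc k) * (real (Suc k))\<^sup>2
            = t * (poisson_weight t k * real k + poisson_weight t k)"
      by (simp add: power2_eq_square algebra_simps)
  qed
  moreover have "(\<lambda>k. t * (poisson_weight t k * real k + poisson_weight t k)) sums (t * (t + 1))"
    by (intro sums_mult sums_add poisson_weight_mean poisson_weight_sums)
  ultimately have "(\<lambda>k. poisson_weight t (Suc k) * (real (Suc k))\<^sup>2) sums (t * (t + 1))" by simp
  from sums_Suc[OF this] show ?thesis by (simp add: power2_eq_square algebra_simps)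
qed

lemma poisson_weight_variance:
  "(\<lambda>k. poisson_weight t k * (real k - t)\<^sup>2) sums t"
proof -
  have "(\<lambda>k. poisson_weight t k * (real k)\<^sup>2 - 2 * t * (poisson_weight t k * real k)
            + t\<^sup>2 * poisson_weight t k) sums (t\<^sup>2 + t - 2 * t * t + t\<^sup>2 * 1)"
    by (intro sums_add sums_diff sums_mult poisson_weight_second_moment poisson_weight_mean
        poisson_weight_sums)
  thus ?thesis
    by (simp add: power2_eq_square algebra_simps)
qed

text \<open>Chebyshev's inequality, in a form that averages a pointwise bound. On one side of
  \<open>m\<close> monotonicity compares \<open>f k\<close> with \<open>f m\<close>; on the other
  side the quotient of squares is at least 1, which exceeds any difference of values in [0, 1]. The
  average of \<open>(k - t)^2\<close> is the variance \<open>t\<close>.\<close>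

lemma
  fixes f :: "nat \<Rightarrow> real"
  assumes "mono f" and f01: "\<And>k. 0 \<le> f k" "\<And>k. f k \<le> 1" and "t \<ge> 0"
    and G: "(\<lambda>k. poisson_weight t k * f k) sums G"
  shows poisson_average_le: "t < real m \<Longrightarrow> G \<le> f m + t / (real m - t)\<^sup>2"
    and poisson_average_ge: "real m < t \<Longrightarrow> f m \<le> G + t / (t - real m)\<^sup>2"
proof -
  \<comment> \<open>Both directions average a function affine in \<open>(k - t)^2\<close>: the first
    takes \<open>s = 1 / (m - t)^2\<close>, the second its negative.\<close>
  have sm: "(\<lambda>k. f m * poisson_weight t k + s * (poisson_weight t k * (real k - t)\<^sup>2))
              sums (f m * 1 + s * t)" for s
    by (intro sums_add sums_mult poisson_weight_sums poisson_weight_variance)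
  show "G \<le> f m + t / (real m - t)\<^sup>2" if tm: "t < real m"
  proof -
    have "f k \<le> f m + (real k - t)\<^sup>2 / (real m - t)\<^sup>2" for k
    proof (cases "k \<le> m")
      case True
      thus ?thesis using monoD[OF \<open>mono f\<close> True] by (simp add: add_increasing2)
    next
      case False
      hence "(real m - t)\<^sup>2 \<le> (real k - t)\<^sup>2" using tm by (intro power_mono) auto
      hence "1 \<le> (real k - t)\<^sup>2 / (real m - t)\<^sup>2" using tm by simp
      thus ?thesis using f01(2)[of k] f01(1)[of m] by linarith
    qed
    hence "poisson_weight t k * f k \<le>
        poisson_weight t k * (f m + (real k - t)\<^sup>2 / (real m - t)\<^sup>2)" for k
      by (intro mult_left_mono poisson_weight_nonneg) (use \<open>t \<ge> 0\<close> in auto)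
    from sums_le[OF _ G sm[of "1 / (real m - t)\<^sup>2"]] this show ?thesis
      by (simp add: algebra_simps)
  qed
  show "f m \<le> G + t / (t - real m)\<^sup>2" if tm: "real m < t"
  proof -
    have "f m - (real k - t)\<^sup>2 / (t - real m)\<^sup>2 \<le> f k" for k
    proof (cases "m \<le> k")
      case True
      have "0 \<le> (real k - t)\<^sup>2 / (t - real m)\<^sup>2" by simp
      thus ?thesis using monoD[OF \<open>mono f\<close> True] by linarith
    next
      case False
      hence "(t - real m)\<^sup>2 \<le> (t - real k)\<^sup>2" using tm by (intro power_mono) auto
      hence "1 \<le> (real k - t)\<^sup>2 / (t - real m)\<^sup>2" using tm by (simp add: power2_commute)
      thus ?thesis using f01(1)[of k] f01(2)[of m] by linarith
    qed
    hence "poisson_weight t k * (f m - (real k - t)\<^sup>2 / (t - real m)\<^sup>2)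
             \<le> poisson_weight t k * f k" for k
      by (intro mult_left_mono poisson_weight_nonneg) (use \<open>t \<ge> 0\<close> in auto)
    from sums_le[OF _ sm[of "- 1 / (t - real m)\<^sup>2"] G] this show ?thesis
      by (simp add: algebra_simps)
  qed
qed

section \<open>Collection probabilities\<close>

context prob_space
begin

lemma prob_avoid_first_draws:
  fixes X :: "nat \<Rightarrow> 'a \<Rightarrow> 'b"
  assumes ind: "indep_vars (\<lambda>_. count_space UNIV) X UNIV"
    and "finite S" and law: "\<And>k i. i \<in> S \<Longrightarrow> prob {\<omega> \<in> space M. X k \<omega> = i} = p i"
  shows "prob {\<omega> \<in> space M. \<forall>k<m. X k \<omega> \<notin> S} = (1 - sum p S) ^ m"
\<comment> \<open>With no draws the intersection used below would have an empty index set and be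
  \<open>UNIV\<close> instead of \<open>space M\<close>.\<close>
proof (cases "m = 0")
  case True
  thus ?thesis by (simp add: prob_space)
next
  case False
  have [measurable]: "X k \<in> measurable M (count_space UNIV)" for k
    using ind by (auto simp: indep_vars_def)
  have single: "prob (X k -` (-S) \<inter> space M) = 1 - sum p S" for k
  proof -
    have "prob (\<Union>i\<in>S. {\<omega> \<in> space M. X k \<omega> = i}) = (\<Sum>i\<in>S. prob {\<omega> \<in> space M. X k \<omega> = i})"
      using \<open>finite S\<close> by (intro finite_measure_finite_Union) (auto simp: disjoint_family_on_def)
    also have "\<dots> = sum p S" by (intro sum.cong) (auto simp: law)
    finally have "prob (\<Union>i\<in>S. {\<omega> \<in> space M. X k \<omega> = i}) = sum p S" .
    moreover have "X k -` (-S) \<inter> space M = space M - (\<Union>i\<in>S. {\<omega> \<in> space M. X k \<omega> = i})" by auto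
    moreover have "(\<Union>i\<in>S. {\<omega> \<in> space M. X k \<omega> = i}) \<in> events"
      using \<open>finite S\<close> by (intro sets.finite_UN) auto
    ultimately show ?thesis by (simp add: prob_compl)
  qed
  have "{\<omega> \<in> space M. \<forall>k<m. X k \<omega> \<notin> S} = (\<Inter>k\<in>{..<m}. X k -` (-S) \<inter> space M)"
    using False by auto
  also have "prob \<dots> = (\<Prod>k<m. prob (X k -` (-S) \<inter> space M))"
    using False by (intro indep_varsD[OF ind]) auto
  also have "\<dots> = (1 - sum p S) ^ m" by (simp add: single)
  finally show ?thesis .
qed

text \<open>Inclusion-exclusion: expand the product over \<open>A\<close> of 1 minus the indicator
  that \<open>i\<close> is missed. The indicators of a subset \<open>S\<close> multiply to that of
  the event that no draw falls in \<open>S\<close>. Draws of types outside \<open>A\<close>, such as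
  type 0, simply avoid every \<open>S\<close>.\<close>

lemma prob_all_drawn:
  fixes X :: "nat \<Rightarrow> 'a \<Rightarrow> 'b"
  assumes ind: "indep_vars (\<lambda>_. count_space UNIV) X UNIV"
    and fin: "finite A" and law: "\<And>k i. i \<in> A \<Longrightarrow> prob {\<omega> \<in> space M. X k \<omega> = i} = p i"
  shows "prob {\<omega> \<in> space M. \<forall>i\<in>A. \<exists>k<m. X k \<omega> = i}
           = (\<Sum>S\<in>Pow A. (-1) ^ card S * (1 - sum p S) ^ m)"
proof -
  have [measurable]: "X k \<in> measurable M (count_space UNIV)" for k
    using ind by (auto simp: indep_vars_def)
  have finS: "finite S" if "S \<in> Pow A" for S using that fin finite_subset by auto
  define E where "E S = {\<omega> \<in> space M. \<forall>k<m. X k \<omega> \<notin> S}" for S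
  define B where "B = {\<omega> \<in> space M. \<forall>i\<in>A. \<exists>k<m. X k \<omega> = i}"
  have E: "E S \<in> events" for S
  proof -
    have eq: "E S = space M - (\<Union>k\<in>{..<m}. X k -` S \<inter> space M)" by (auto simp: E_def)
    show ?thesis
      unfolding eq
      by (intro sets.Diff sets.top sets.finite_UN measurable_sets[of "X _" M "count_space UNIV"]) auto
  qed
  have B: "B \<in> events" unfolding B_def using fin by measurable
  have pointwise: "indicat_real B \<omega> = (\<Sum>S\<in>Pow A. (-1) ^ card S * indicat_real (E S) \<omega>)"
    if w: "\<omega> \<in> space M" for \<omega>
  proof -
    have prod_ind: "(\<Prod>i\<in>S. (if P i then 1 else (0::real))) = (if \<forall>i\<in>S. P i then 1 else 0)"
      if "finite S" for P and S :: "'b set"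
      using that by (induction S rule: finite_induct) auto
    have "indicat_real B \<omega> = (\<Prod>i\<in>A. (if \<exists>k<m. X k \<omega> = i then 1 else (0::real)))"
      using w by (subst prod_ind[OF fin]) (auto simp: B_def indicator_def)
    also have "\<dots> = (\<Prod>i\<in>A. - (if \<forall>k<m. X k \<omega> \<noteq> i then 1 else 0) + (1::real))"
      by (intro prod.cong) auto
    also have "\<dots> = (\<Sum>S\<in>Pow A. (\<Prod>i\<in>S. - (if \<forall>k<m. X k \<omega> \<noteq> i then 1 else 0)) * (\<Prod>i\<in>A-S. 1))"
      by (rule prod_add[OF fin])
    also have "\<dots> = (\<Sum>S\<in>Pow A. (-1) ^ card S * indicat_real (E S) \<omega>)"
    proof (intro sum.cong refl)
      fix S assume S: "S \<in> Pow A"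
      have "(\<Prod>i\<in>S. - (if \<forall>k<m. X k \<omega> \<noteq> i then 1 else (0::real)))
              = (-1) ^ card S * (if \<forall>i\<in>S. \<forall>k<m. X k \<omega> \<noteq> i then 1 else 0)"
        by (subst prod_uminus) (simp only: prod_ind[OF finS[OF S]])
      thus "(\<Prod>i\<in>S. - (if \<forall>k<m. X k \<omega> \<noteq> i then 1 else (0::real))) * (\<Prod>i\<in>A-S. 1)
              = (-1) ^ card S * indicat_real (E S) \<omega>"
        using w by (auto simp: E_def indicator_def)
    qed
    finally show ?thesis .
  qed
  have "prob B = expectation (indicat_real B)" using B by simp
  also have "\<dots> = expectation (\<lambda>\<omega>. \<Sum>S\<in>Pow A. (-1) ^ card S * indicat_real (E S) \<omega>)"
    by (intro Bochner_Integration.integral_cong refl pointwise)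
  also have "\<dots> = (\<Sum>S\<in>Pow A. (-1) ^ card S * prob (E S))"
    using E by (subst Bochner_Integration.integral_sum) (auto simp: emeasure_eq_measure)
  also have "\<dots> = (\<Sum>S\<in>Pow A. (-1) ^ card S * (1 - sum p S) ^ m)"
  proof (intro sum.cong refl)
    fix S assume S: "S \<in> Pow A"
    show "(-1) ^ card S * prob (E S) = (-1) ^ card S * (1 - sum p S) ^ m"
      unfolding E_def using S by (subst prob_avoid_first_draws[OF ind finS[OF S]]) (auto intro: law)
  qed
  finally show ?thesis unfolding B_def .
qed

text \<open>Poissonisation. Averaging turns \<open>(1 - sum p S) ^ m\<close> into
  \<open>exp (- t * sum p S)\<close>, which is multiplicative over \<open>S\<close>, so the
  alternating sum folds back into a product. This reflects that the type counts among Poisson(t)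
  many draws are independent, without constructing such a sample.\<close>

lemma poisson_average_all_drawn:
  fixes X :: "nat \<Rightarrow> 'a \<Rightarrow> 'b"
  assumes ind: "indep_vars (\<lambda>_. count_space UNIV) X UNIV"
    and fin: "finite A" and law: "\<And>k i. i \<in> A \<Longrightarrow> prob {\<omega> \<in> space M. X k \<omega> = i} = p i"
  shows "(\<lambda>m. poisson_weight t m * prob {\<omega> \<in> space M. \<forall>i\<in>A. \<exists>k<m. X k \<omega> = i})
           sums (\<Prod>i\<in>A. 1 - exp (- (t * p i)))"
proof -
  have "(\<lambda>m. \<Sum>S\<in>Pow A. (-1) ^ card S * (poisson_weight t m * (1 - sum p S) ^ m))
          sums (\<Sum>S\<in>Pow A. (-1) ^ card S * exp (- (t * (1 - (1 - sum p S)))))"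
    by (intro sums_sum sums_mult poisson_weight_power_sums)
  also have "(\<lambda>m. \<Sum>S\<in>Pow A. (-1) ^ card S * (poisson_weight t m * (1 - sum p S) ^ m))
      = (\<lambda>m. poisson_weight t m * prob {\<omega> \<in> space M. \<forall>i\<in>A. \<exists>k<m. X k \<omega> = i})"
    by (simp add: prob_all_drawn[OF ind fin law] sum_distrib_left mult_ac)
  also have "(\<Sum>S\<in>Pow A. (-1) ^ card S * exp (- (t * (1 - (1 - sum p S)))))
      = (\<Sum>S\<in>Pow A. (\<Prod>i\<in>S. - exp (- (t * p i))) * (\<Prod>i\<in>A-S. 1))"
  proof (intro sum.cong refl)
    fix S assume "S \<in> Pow A"
    hence "finite S" using fin finite_subset by auto
    thus "(-1) ^ card S * exp (- (t * (1 - (1 - sum p S))))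
            = (\<Prod>i\<in>S. - exp (- (t * p i))) * (\<Prod>i\<in>A-S. 1)"
      by (subst prod_uminus) (simp add: exp_sum[symmetric] sum_distrib_left sum_negf)
  qed
  also have "\<dots> = (\<Prod>i\<in>A. - exp (- (t * p i)) + 1)" by (rule prod_add[OF fin, symmetric])
  finally show ?thesis by simp
qed

lemma mono_prob_all_drawn:
  fixes X :: "nat \<Rightarrow> 'a \<Rightarrow> 'b"
  assumes [measurable]: "\<And>k. X k \<in> measurable M (count_space UNIV)" and "finite A"
  shows "mono (\<lambda>m. prob {\<omega> \<in> space M. \<forall>i\<in>A. \<exists>k<m. X k \<omega> = i})"
proof (rule monoI)
  fix m n :: nat assume mn: "m \<le> n"
  have "{\<omega> \<in> space M. \<forall>i\<in>A. \<exists>k<n. X k \<omega> = i} \<in> events" using \<open>finite A\<close> by measurable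
  thus "prob {\<omega> \<in> space M. \<forall>i\<in>A. \<exists>k<m. X k \<omega> = i} \<le> prob {\<omega> \<in> space M. \<forall>i\<in>A. \<exists>k<n. X k \<omega> = i}"
    using mn by (intro finite_measure_mono) (auto, meson order_less_le_trans)
qed

text \<open>A type \<open>i\<close> is missed forever with probability at most
  \<open>(1 - p i) ^ m\<close> for every \<open>m\<close>, hence 0. This makes the event on which
  \<open>collect_time\<close> has its junk value a null event.\<close>

lemma AE_all_drawn:
  fixes X :: "nat \<Rightarrow> 'a \<Rightarrow> 'b"
  assumes ind: "indep_vars (\<lambda>_. count_space UNIV) X UNIV"
    and fin: "finite A" and law: "\<And>k i. i \<in> A \<Longrightarrow> prob {\<omega> \<in> space M. X k \<omega> = i} = p i"
    and pos: "\<And>i. i \<in> A \<Longrightarrow> p i > 0"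
  shows "AE \<omega> in M. \<exists>m. \<forall>i\<in>A. \<exists>k<m. X k \<omega> = i"
proof -
  have [measurable]: "X k \<in> measurable M (count_space UNIV)" for k
    using ind by (auto simp: indep_vars_def)
  have "AE \<omega> in M. \<exists>k. X k \<omega> = i" if i: "i \<in> A" for i
  proof -
    define Z where "Z = {\<omega> \<in> space M. \<forall>k. X k \<omega> \<noteq> i}"
    have [measurable]: "Z \<in> events" unfolding Z_def by measurable
    have le: "prob Z \<le> (1 - p i) ^ m" for m
    proof -
      have "prob Z \<le> prob {\<omega> \<in> space M. \<forall>k<m. X k \<omega> \<notin> {i}}"
        by (intro finite_measure_mono) (auto simp: Z_def)
      also have "\<dots> = (1 - p i) ^ m"
        using i by (subst prob_avoid_first_draws[OF ind, where p = p]) (auto intro: law)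
      finally show ?thesis .
    qed
    have "p i \<le> 1" using law[OF i, of 0] prob_le_1 by metis
    hence "(\<lambda>m. (1 - p i) ^ m) \<longlonglongrightarrow> 0"
      using pos[OF i] by (intro LIMSEQ_realpow_zero) auto
    hence "prob Z \<le> 0" using le by (intro LIMSEQ_le_const) auto
    hence "prob Z = 0" using measure_nonneg[of M Z] by linarith
    hence "Z \<in> null_sets M" by (simp add: null_sets_def emeasure_eq_measure)
    thus ?thesis by (rule AE_I') (auto simp: Z_def)
  qed
  hence "AE \<omega> in M. \<forall>i\<in>A. \<exists>k. X k \<omega> = i" using fin by (intro AE_finite_allI) auto
  thus ?thesis
  proof eventually_elim
    case (elim \<omega>)
    then obtain k where k: "\<And>i. i \<in> A \<Longrightarrow> X (k i) \<omega> = i" by metis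
    obtain m where "\<And>i. i \<in> A \<Longrightarrow> k i < m"
      using finite_nat_set_iff_bounded[of "k ` A"] fin by auto
    with k show ?case by blast
  qed
qed

end

section \<open>The collection time as a random variable\<close>

lemma measurable_collect_time:
  assumes [measurable]: "\<And>k. X k \<in> measurable M (count_space UNIV)"
  shows "collect_time n X \<in> measurable M (count_space UNIV)"
proof -
  have "collect_time n X = (\<lambda>\<omega>. LEAST m. \<forall>i\<in>{1..n}. \<exists>k<m. X k \<omega> = i)"
    by (simp add: collect_time_def Inf_nat_def fun_eq_iff)
  also have "\<dots> \<in> measurable M (count_space UNIV)" by measurable
  finally show ?thesis .
qed

text \<open>The assumption excludes the infimum of the empty set. The infimum is then attained, and
  the condition on \<open>m\<close> is inherited by larger \<open>m\<close>.\<close>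

lemma collect_time_le_iff:
  assumes "\<exists>m. \<forall>i\<in>{1..n}. \<exists>k<m. X k \<omega> = i"
  shows "collect_time n X \<omega> \<le> m \<longleftrightarrow> (\<forall>i\<in>{1..n}. \<exists>k<m. X k \<omega> = i)"
proof
  assume le: "collect_time n X \<omega> \<le> m"
  have "collect_time n X \<omega> \<in> {m. \<forall>i\<in>{1..n}. \<exists>k<m. X k \<omega> = i}"
    unfolding collect_time_def by (rule Inf_nat_def1) (use assms in auto)
  thus "\<forall>i\<in>{1..n}. \<exists>k<m. X k \<omega> = i" using le by (auto dest!: bspec intro: less_le_trans)
next
  assume "\<forall>i\<in>{1..n}. \<exists>k<m. X k \<omega> = i"
  thus "collect_time n X \<omega> \<le> m"
    unfolding collect_time_def by (intro cInf_lower) auto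
qed

section \<open>Sums and products along a geometric progression\<close>

text \<open>Bernoulli's inequality replaces \<open>r ^ j\<close> by \<open>1 + j * (r - 1)\<close>,
  so that a geometric series with ratio \<open>x = exp (- (K * (r - 1)))\<close> dominates the
  sum.\<close>

lemma sum_exp_geometric_le:
  fixes K r :: real
  assumes "K > 0" "r > 1"
  shows "(\<Sum>j<n. exp (- (K * r ^ j))) \<le> exp (-K) * (1 + 1 / (K * (r - 1)))"
proof -
  define x where "x = exp (- (K * (r - 1)))"
  have x: "0 < x" "x < 1" using assms by (auto simp: x_def)
  have "exp (- (K * r ^ j)) \<le> exp (-K) * x ^ j" for j
  proof -
    have "1 + real j * (r - 1) \<le> (1 + (r - 1)) ^ j"
      using assms by (intro Bernoulli_inequality) auto
    hence "K * (1 + real j * (r - 1)) \<le> K * r ^ j" using assms by simp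
    hence "exp (- (K * r ^ j)) \<le> exp (- K - real j * (K * (r - 1)))"
      by (simp add: algebra_simps)
    also have "\<dots> = exp (-K) * x ^ j"
      by (simp add: x_def exp_diff exp_minus divide_inverse power_inverse flip: exp_of_nat_mult)
    finally show ?thesis .
  qed
  hence "(\<Sum>j<n. exp (- (K * r ^ j))) \<le> exp (-K) * (\<Sum>j<n. x ^ j)"
    by (simp add: sum_distrib_left sum_mono)
  also have "(\<Sum>j<n. x ^ j) \<le> (\<Sum>j. x ^ j)"
    using x by (intro sum_le_suminf summable_geometric) auto
  also have "(\<Sum>j. x ^ j) = 1 / (1 - x)" using x by (intro suminf_geometric) auto
  \<comment> \<open>With \<open>y = K * (r - 1)\<close>, the inequality
    \<open>exp y >= 1 + y\<close> says \<open>x * (1 + y) <= 1\<close>, which rearranges to the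
    claim.\<close>
  also have "1 / (1 - x) \<le> 1 + 1 / (K * (r - 1))"
  proof -
    have y: "K * (r - 1) > 0" using assms by simp
    have "x * (1 + K * (r - 1)) \<le> x * exp (K * (r - 1))"
      using x exp_ge_add_one_self[of "K * (r - 1)"] by (intro mult_left_mono) auto
    also have "\<dots> = 1" by (simp add: x_def flip: exp_add)
    finally have "K * (r - 1) \<le> (1 + K * (r - 1)) * (1 - x)" by (simp add: algebra_simps)
    moreover have "1 + 1 / (K * (r - 1)) = (1 + K * (r - 1)) / (K * (r - 1))"
      using assms by (simp add: field_simps)
    ultimately show ?thesis using x y by (simp add: divide_le_eq pos_le_divide_eq)
  qed
  finally show ?thesis by simp
qed

(* The differences of exp (-x) / x along x = K * r ^ j telescope, and each of them is at most
   (r - 1) * (1 + 1 / K) times the corresponding summand. *)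
lemma sum_exp_geometric_ge:
  fixes K r :: real
  assumes K: "K > 0" and r: "r > 1"
  shows "exp (-K) * (1 - exp (- (K * (real n * (r - 1))))) / ((r - 1) * (K + 1))
           \<le> (\<Sum>j<n. exp (- (K * r ^ j)))"
proof -
  have step: "exp (-x) / x - exp (- (x * r)) / (x * r) \<le> (r - 1) * (1 + 1 / K) * exp (-x)"
    if x: "x \<ge> K" for x
  proof -
    have x0: "x > 0" using x K by simp
    have "1 - x * (r - 1) \<le> exp (- (x * (r - 1)))"
      using exp_ge_add_one_self[of "- (x * (r - 1))"] by simp
    hence "1 - exp (- (x * (r - 1))) / r \<le> 1 - (1 - x * (r - 1)) / r"
      using r by (simp add: divide_right_mono)
    also have "\<dots> = (r - 1) * (1 + x) / r" using r by (simp add: field_simps)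
    also have "\<dots> \<le> (r - 1) * (1 + x)"
      using r x0 by (simp add: divide_le_eq)
    finally have "1 - exp (- (x * (r - 1))) / r \<le> (r - 1) * (1 + x)" .
    hence "exp (-x) / x * (1 - exp (- (x * (r - 1))) / r) \<le> exp (-x) / x * ((r - 1) * (1 + x))"
      using x0 by (intro mult_left_mono) auto
    moreover have "exp (- (x * r)) = exp (-x) * exp (- (x * (r - 1)))"
      by (simp add: algebra_simps flip: exp_add)
    ultimately have "exp (-x) / x - exp (- (x * r)) / (x * r) \<le> (r - 1) * (1 + 1 / x) * exp (-x)"
      using x0 r by (simp add: field_simps)
    also have "\<dots> \<le> (r - 1) * (1 + 1 / K) * exp (-x)"
      using x K r by (intro mult_right_mono mult_left_mono add_left_mono divide_left_mono) auto
    finally show ?thesis .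
  qed
  have telescope: "exp (-K) / K - exp (- (K * r ^ n)) / (K * r ^ n)
                     \<le> (r - 1) * (1 + 1 / K) * (\<Sum>j<n. exp (- (K * r ^ j)))" for n
  proof (induction n)
    case (Suc n)
    have "1 \<le> r ^ n" using r by simp
    hence "K \<le> K * r ^ n" using K by simp
    from step[OF this] Suc.IH show ?case by (simp add: algebra_simps)
  qed auto
  \<comment> \<open>Bernoulli makes the boundary term at \<open>r ^ n\<close> a multiple of
    \<open>exp (-K) / K\<close>, the other boundary term; in its denominator
    \<open>r ^ n >= 1\<close> is enough.\<close>
  have rn: "r ^ n \<ge> 1 + real n * (r - 1)"
    using Bernoulli_inequality[of "r - 1" n] r by simp
  hence rn1: "r ^ n \<ge> 1" using r one_le_power[of r n] by linarith
  have "exp (- (K * r ^ n)) / (K * r ^ n) \<le> exp (- (K * (1 + real n * (r - 1)))) / K"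
    using K rn rn1 by (intro frac_le) auto
  also have "\<dots> = exp (-K) * exp (- (K * (real n * (r - 1)))) / K"
    by (simp add: algebra_simps flip: exp_add)
  finally have "exp (-K) * (1 - exp (- (K * (real n * (r - 1))))) / K
      \<le> (r - 1) * (1 + 1 / K) * (\<Sum>j<n. exp (- (K * r ^ j)))"
    using telescope[of n] by (simp add: algebra_simps diff_divide_distrib)
  also have "\<dots> = (r - 1) * (K + 1) * (\<Sum>j<n. exp (- (K * r ^ j))) / K"
    using K by (simp add: field_simps)
  finally have "exp (-K) * (1 - exp (- (K * (real n * (r - 1)))))
      \<le> (r - 1) * (K + 1) * (\<Sum>j<n. exp (- (K * r ^ j)))"
    using K by (simp add: divide_le_cancel)
  thus ?thesis using K r by (simp add: pos_divide_le_eq mult_ac)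
qed

section \<open>Comparison of products with exponentials of sums\<close>

lemma prod_one_minus_le_exp:
  fixes x :: "'i \<Rightarrow> real"
  assumes "\<And>i. i \<in> A \<Longrightarrow> x i \<le> 1"
  shows "(\<Prod>i\<in>A. 1 - x i) \<le> exp (- sum x A)"
\<comment> \<open>For infinite \<open>A\<close> the sum is 0 and the product 1 by default, so both
  sides are 1.\<close>
proof (cases "finite A")
  case True
  have "(\<Prod>i\<in>A. 1 - x i) \<le> (\<Prod>i\<in>A. exp (- x i))"
  proof (intro prod_mono conjI)
    fix i assume "i \<in> A"
    thus "0 \<le> 1 - x i" using assms by simp
    show "1 - x i \<le> exp (- x i)" using exp_ge_add_one_self[of "- x i"] by simp
  qed
  thus ?thesis using True by (simp add: exp_sum[symmetric] sum_negf)
qed simp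

text \<open>From \<open>ln (1 - x) >= - x - 2 * x^2\<close> on [0, 1/2]. Bounding one factor of
  \<open>x^2\<close> by \<open>y\<close> leaves only a factor \<open>1 + 2 * y\<close> on the sum,
  which tends to 1 in the use with \<open>y = exp (-K)\<close>.\<close>

lemma prod_one_minus_ge_exp:
  fixes x :: "'i \<Rightarrow> real"
  assumes x: "\<And>i. i \<in> A \<Longrightarrow> 0 \<le> x i" "\<And>i. i \<in> A \<Longrightarrow> x i \<le> y" and y: "y \<le> 1 / 2"
  shows "exp (- (sum x A * (1 + 2 * y))) \<le> (\<Prod>i\<in>A. 1 - x i)"
proof (cases "finite A")
  case True
  have "exp (- (sum x A * (1 + 2 * y))) = (\<Prod>i\<in>A. exp (- (x i * (1 + 2 * y))))"
    using True by (simp add: exp_sum[symmetric] sum_negf sum_distrib_right)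
  also have "\<dots> \<le> (\<Prod>i\<in>A. 1 - x i)"
  proof (intro prod_mono conjI)
    fix i assume i: "i \<in> A"
    have "x i * x i \<le> x i * y" using x[OF i] by (intro mult_left_mono) auto
    hence "- (x i * (1 + 2 * y)) \<le> - x i - 2 * (x i)\<^sup>2"
      by (simp add: power2_eq_square algebra_simps)
    also have "\<dots> \<le> ln (1 - x i)"
      using x[OF i] y by (intro ln_one_minus_pos_lower_bound) auto
    finally show "exp (- (x i * (1 + 2 * y))) \<le> 1 - x i"
      using x[OF i] y by (simp add: ln_ge_iff)
  qed simp
  finally show ?thesis .
qed simp

section \<open>The bounds for the coupon probabilities\<close>

lemma coupon_prob_pos: "0 < lam \<Longrightarrow> lam < real n \<Longrightarrow> coupon_prob lam n i > 0"
  by (auto simp: coupon_prob_def Let_def)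

text \<open>Types are counted backwards from the rarest one, \<open>n\<close>; each step divides by
  \<open>1 - lam / n\<close>, that is, multiplies by \<open>n / (n - lam)\<close>.\<close>

lemma coupon_prob_geometric:
  assumes "0 < lam" "lam < real n" "j < n"
  shows "coupon_prob lam n (n - j) = coupon_prob lam n n * (real n / (real n - lam)) ^ j"
proof -
  \<comment> \<open>\<open>n - j\<close> is nonzero, so the separate case \<open>i = 0\<close> of
    \<open>coupon_prob\<close> is not hit.\<close>
  have n: "n - 1 = (n - j - 1) + j" "n - j \<noteq> 0" "n \<noteq> 0" using assms by auto
  have "(1 - lam / real n) * (real n / (real n - lam)) = 1"
    using assms n by (simp add: field_simps)
  hence "(1 - lam / real n) ^ j * (real n / (real n - lam)) ^ j = 1"
    by (metis power_mult_distrib power_one)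
  hence "(1 - lam / real n) ^ (n - 1) * (real n / (real n - lam)) ^ j = (1 - lam / real n) ^ (n - j - 1)"
    by (subst n(1)) (simp only: power_add mult.assoc mult_1_right)
  thus ?thesis using n by (simp add: coupon_prob_def Let_def)
qed

text \<open>This splits off the leading order \<open>lam * exp (-lam) / n\<close> of
  \<open>p_n\<close>. The remaining exponential is 1 + O(1/n) and is written with real exponents,
  ready for asymptotics in a real variable.\<close>

lemma coupon_prob_last:
  assumes "0 < lam" "lam < real n"
  shows "K / coupon_prob lam n n
           = exp lam / lam * real n * K / exp (lam + (real n - 1) * ln (1 - lam / real n))"
proof -
  have n: "n > 0" using assms by (cases n) auto
  have "exp (real (n - 1) * ln (1 - lam / real n)) = exp (ln (1 - lam / real n)) ^ (n - 1)"
    by (rule exp_of_nat_mult)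
  hence "(1 - lam / real n) ^ (n - 1) = exp ((real n - 1) * ln (1 - lam / real n))"
    using assms n by (simp add: of_nat_diff)
  hence "coupon_prob lam n n
           = lam / (exp lam * real n) * exp (lam + (real n - 1) * ln (1 - lam / real n))"
    using n by (simp add: coupon_prob_def Let_def exp_add)
  thus ?thesis by simp
qed

text \<open>The choice of \<open>t\<close> makes \<open>t * p_n = K\<close>, so the factors become
  \<open>1 - exp (- (K * r ^ j))\<close> with \<open>r = n / (n - lam)\<close>, and the sum bounds
  apply with \<open>r - 1 = lam / (n - lam)\<close>.\<close>

lemma
  assumes lam: "0 < lam" "lam < real n" and K: "K > 0"
    and t: "t = K / coupon_prob lam n n"
  defines "P \<equiv> (\<Prod>i\<in>{1..n}. 1 - exp (- (t * coupon_prob lam n i)))"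
  shows poisson_product_le:
      "P \<le> exp (- (exp (-K) * (1 - exp (- (K * lam))) * (real n - lam) / (lam * (K + 1))))"
    and poisson_product_ge: "exp (-K) \<le> 1 / 2 \<Longrightarrow>
      exp (- (exp (-K) * (1 + (real n - lam) / (K * lam)) * (1 + 2 * exp (-K)))) \<le> P"
proof -
  define r where "r = real n / (real n - lam)"
  have r: "r > 1" "r - 1 = lam / (real n - lam)" using lam by (auto simp: r_def field_simps)
  define x where "x j = exp (- (K * r ^ j))" for j
  define S where "S = (\<Sum>j<n. x j)"
  have "P = (\<Prod>j<n. 1 - exp (- (t * coupon_prob lam n (n - j))))"
    unfolding P_def by (rule prod.reindex_bij_witness[of _ "\<lambda>j. n - j" "\<lambda>i. n - i"]) auto
  also have "\<dots> = (\<Prod>j<n. 1 - x j)"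
  proof (intro prod.cong refl)
    fix j assume "j \<in> {..<n}"
    moreover have "coupon_prob lam n n > 0" using lam by (rule coupon_prob_pos)
    ultimately show "1 - exp (- (t * coupon_prob lam n (n - j))) = 1 - x j"
      using coupon_prob_geometric[OF lam, of j] by (simp add: t x_def r_def)
  qed
  finally have P: "P = (\<Prod>j<n. 1 - x j)" .
  have "r ^ j \<ge> 1" for j using r by simp
  hence xK: "x j \<le> exp (-K)" for j using K by (simp add: x_def)
  have x1: "x j \<le> 1" for j using K r by (simp add: x_def)
  show "P \<le> exp (- (exp (-K) * (1 - exp (- (K * lam))) * (real n - lam) / (lam * (K + 1))))"
  proof -
    have nr: "lam \<le> real n * (r - 1)" using lam r by (simp add: field_simps)
    have "exp (-K) * (1 - exp (- (K * lam))) * (real n - lam) / (lam * (K + 1))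
            = exp (-K) * (1 - exp (- (K * lam))) / ((r - 1) * (K + 1))"
      using lam K unfolding r(2) by (simp add: field_simps)
    also have "\<dots> \<le> exp (-K) * (1 - exp (- (K * (real n * (r - 1))))) / ((r - 1) * (K + 1))"
      using K r(1) nr by (intro divide_right_mono mult_left_mono) auto
    also have "\<dots> \<le> S" unfolding S_def x_def by (rule sum_exp_geometric_ge[OF K r(1)])
    finally have "exp (- S) \<le>
      exp (- (exp (-K) * (1 - exp (- (K * lam))) * (real n - lam) / (lam * (K + 1))))" by simp
    moreover have "P \<le> exp (- S)" unfolding P S_def using x1 by (intro prod_one_minus_le_exp)
    ultimately show ?thesis by linarith
  qed
  show "exp (- (exp (-K) * (1 + (real n - lam) / (K * lam)) * (1 + 2 * exp (-K)))) \<le> P"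
    if half: "exp (-K) \<le> 1 / 2"
  proof -
    have "S \<le> exp (-K) * (1 + (real n - lam) / (K * lam))"
      using sum_exp_geometric_le[OF K r(1), of n] lam by (simp add: S_def x_def r(2))
    hence "S * (1 + 2 * exp (-K))
        \<le> exp (-K) * (1 + (real n - lam) / (K * lam)) * (1 + 2 * exp (-K))"
      by (intro mult_right_mono) (auto intro: add_nonneg_nonneg)
    hence "exp (- (exp (-K) * (1 + (real n - lam) / (K * lam)) * (1 + 2 * exp (-K))))
        \<le> exp (- (S * (1 + 2 * exp (-K))))" by simp
    also have "\<dots> \<le> P"
      unfolding P S_def using xK half by (intro prod_one_minus_ge_exp) (auto simp: x_def)
    finally show ?thesis .
  qed
qed

text \<open>\<open>D' <= d\<close> means \<open>D <= s\<close>, and \<open>D\<close> is an integer,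
  so \<open>s\<close> may be rounded down; \<open>s >= 0\<close> keeps \<open>nat\<close> from
  changing the floor. The two events differ only where some type never appears.\<close>

lemma (in prob_space) cdf_norm_collect_time:
  assumes ind: "indep_vars (\<lambda>_. count_space UNIV) X UNIV"
    and lam: "0 < lam" "lam < real n"
    and law: "\<And>k i. i \<in> {1..n} \<Longrightarrow> prob {\<omega> \<in> space M. X k \<omega> = i} = coupon_prob lam n i"
    and s: "s = exp lam / lam * real n * (ln (real n) - ln (ln (real n))) + d * real n" "s \<ge> 0"
  shows "cdf (distr M borel (norm_collect_time lam n X)) d
           = prob {\<omega> \<in> space M. \<forall>i\<in>{1..n}. \<exists>k<nat \<lfloor>s\<rfloor>. X k \<omega> = i}"
proof -
  have [measurable]: "X k \<in> measurable M (count_space UNIV)" for k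
    using ind by (auto simp: indep_vars_def)
  have [measurable]: "collect_time n X \<in> measurable M (count_space UNIV)"
    by (rule measurable_collect_time) measurable
  have meas [measurable]: "norm_collect_time lam n X \<in> borel_measurable M"
    unfolding norm_collect_time_def by measurable
  have iff: "norm_collect_time lam n X \<omega> \<le> d \<longleftrightarrow> collect_time n X \<omega> \<le> nat \<lfloor>s\<rfloor>" for \<omega>
  proof -
    have "norm_collect_time lam n X \<omega> \<le> d \<longleftrightarrow> real (collect_time n X \<omega>) \<le> s"
      using lam by (simp add: norm_collect_time_def s pos_divide_le_eq algebra_simps)
    also have "\<dots> \<longleftrightarrow> collect_time n X \<omega> \<le> nat \<lfloor>s\<rfloor>"
      using \<open>s \<ge> 0\<close> by (simp add: le_nat_iff le_floor_iff)
    finally show ?thesis .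
  qed
  have drawn: "AE \<omega> in M. \<exists>m. \<forall>i\<in>{1..n}. \<exists>k<m. X k \<omega> = i"
    by (rule AE_all_drawn[OF ind _ law coupon_prob_pos[OF lam]]) auto
  have "cdf (distr M borel (norm_collect_time lam n X)) d
          = prob {\<omega> \<in> space M. norm_collect_time lam n X \<omega> \<le> d}"
    unfolding cdf_def by (subst measure_distr) (auto intro!: arg_cong[of _ _ prob])
  also have "\<dots> = prob {\<omega> \<in> space M. \<forall>i\<in>{1..n}. \<exists>k<nat \<lfloor>s\<rfloor>. X k \<omega> = i}"
  proof (rule finite_measure_eq_AE)
    show "AE \<omega> in M. \<omega> \<in> {\<omega> \<in> space M. norm_collect_time lam n X \<omega> \<le> d}
            \<longleftrightarrow> \<omega> \<in> {\<omega> \<in> space M. \<forall>i\<in>{1..n}. \<exists>k<nat \<lfloor>s\<rfloor>. X k \<omega> = i}"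
      using drawn by eventually_elim (auto simp: iff collect_time_le_iff)
  qed measurable
  finally show ?thesis .
qed

text \<open>De-Poissonised bounds. \<open>K\<close> is free as long as \<open>t\<close> lies on the
  right side of \<open>m\<close>; the theorem uses two values of \<open>K\<close>, one for each
  direction.\<close>

lemma (in prob_space)
  assumes ind: "indep_vars (\<lambda>_. count_space UNIV) X UNIV"
    and lam: "0 < lam" "lam < real n"
    and law: "\<And>k i. i \<in> {1..n} \<Longrightarrow> prob {\<omega> \<in> space M. X k \<omega> = i} = coupon_prob lam n i"
    and K: "K > 0" and t: "t = K / coupon_prob lam n n"
  defines "f m \<equiv> prob {\<omega> \<in> space M. \<forall>i\<in>{1..n}. \<exists>k<m. X k \<omega> = i}"
  shows all_drawn_le: "real m < t \<Longrightarrow>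
      f m \<le> exp (- (exp (-K) * (1 - exp (- (K * lam))) * (real n - lam) / (lam * (K + 1))))
              + t / (t - real m)\<^sup>2"
    and all_drawn_ge: "t < real m \<Longrightarrow> exp (-K) \<le> 1 / 2 \<Longrightarrow>
      exp (- (exp (-K) * (1 + (real n - lam) / (K * lam)) * (1 + 2 * exp (-K))))
        \<le> f m + t / (real m - t)\<^sup>2"
proof -
  have meas: "X k \<in> measurable M (count_space UNIV)" for k
    using ind by (auto simp: indep_vars_def)
  have f: "mono f" "0 \<le> f k" "f k \<le> 1" for k
    unfolding f_def using mono_prob_all_drawn[OF meas, of "{1..n}"] by auto
  have "t \<ge> 0" using K coupon_prob_pos[OF lam, of n] by (simp add: t)
  have "(\<lambda>m. poisson_weight t m * f m) sums (\<Prod>i\<in>{1..n}. 1 - exp (- (t * coupon_prob lam n i)))"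
    unfolding f_def by (rule poisson_average_all_drawn[OF ind _ law]) auto
  note avg = f \<open>t \<ge> 0\<close> this
  show "f m \<le> exp (- (exp (-K) * (1 - exp (- (K * lam))) * (real n - lam) / (lam * (K + 1))))
              + t / (t - real m)\<^sup>2" if "real m < t"
    using poisson_average_ge[OF avg that] poisson_product_le[OF lam K t] by linarith
  show "exp (- (exp (-K) * (1 + (real n - lam) / (K * lam)) * (1 + 2 * exp (-K))))
        \<le> f m + t / (real m - t)\<^sup>2" if "t < real m" "exp (-K) \<le> 1 / 2"
    using poisson_average_le[OF avg that(1)] poisson_product_ge[OF lam K t that(2)] by linarith
qed

section \<open>Asymptotics\<close>

text \<open>Here \<open>exp (- K x)\<close> is \<open>exp (-c) * ln x / x\<close> up to a factor
  tending to 1. The rate comes from \<open>ln x / (K x + 1) = 1 + O(ln (ln x) / ln x)\<close>; the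
  other factors differ from 1 by negative powers of \<open>x\<close>, up to logarithms.\<close>

lemma gumbel_exponent_lower_asymp:
  fixes lam c :: real
  assumes lam: "lam > 0"
  defines "K \<equiv> \<lambda>x. ln x - ln (ln x) + c + x powr (-1/4)"
  shows "(\<lambda>x. exp (- K x) * (1 - exp (- (K x * lam))) * (x - lam) / (lam * (K x + 1))
            - exp (-c) / lam) \<in> O(\<lambda>x. ln (ln x) / ln x)"
proof -
  have "(\<lambda>x. exp (-c) / lam * (exp (- (x powr (-1/4))) * ln x * ((x - lam) / x) / (K x + 1)
          * (1 - exp (- K x * lam))) - exp (-c) / lam) \<in> O(\<lambda>x. ln (ln x) / ln x)"
    unfolding K_def using lam by real_asymp
  also have "?this \<longleftrightarrow> ?thesis"
  proof (rule landau_o.big.in_cong)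
    show "\<forall>\<^sub>F x in at_top. exp (-c) / lam * (exp (- (x powr (-1/4))) * ln x * ((x - lam) / x)
          / (K x + 1) * (1 - exp (- K x * lam))) - exp (-c) / lam
        = exp (- K x) * (1 - exp (- (K x * lam))) * (x - lam) / (lam * (K x + 1)) - exp (-c) / lam"
      \<comment> \<open>For \<open>x > 1\<close> the logarithm is positive, hence
        \<open>exp (ln (ln x)) = ln x\<close>.\<close>
      using eventually_gt_at_top[of 1]
    proof eventually_elim
      case (elim x)
      hence "exp (- K x) = exp (-c) * exp (- (x powr (-1/4))) * (ln x / x)"
        by (simp add: K_def exp_diff exp_add exp_minus field_simps)
      thus ?case by (simp add: mult_ac)
    qed
  qed
  finally show ?thesis .
qed

lemma gumbel_exponent_upper_asymp:
  fixes lam c :: real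
  assumes lam: "lam > 0"
  defines "K \<equiv> \<lambda>x. ln x - ln (ln x) + c - x powr (-1/4)"
  shows "(\<lambda>x. exp (- K x) * (1 + (x - lam) / (K x * lam)) * (1 + 2 * exp (- K x))
            - exp (-c) / lam) \<in> O(\<lambda>x. ln (ln x) / ln x)"
proof -
  define g where "g x = exp (x powr (-1/4)) * (ln x / x)" for x :: real
  have "(\<lambda>x. exp (-c) / lam * (g x * (lam + (x - lam) / K x) * (1 + 2 * (exp (-c) * g x)))
           - exp (-c) / lam) \<in> O(\<lambda>x. ln (ln x) / ln x)"
    unfolding g_def K_def using lam by real_asymp
  also have "?this \<longleftrightarrow> ?thesis"
  proof (rule landau_o.big.in_cong)
    show "\<forall>\<^sub>F x in at_top.
        exp (-c) / lam * (g x * (lam + (x - lam) / K x) * (1 + 2 * (exp (-c) * g x)))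
          - exp (-c) / lam
        = exp (- K x) * (1 + (x - lam) / (K x * lam)) * (1 + 2 * exp (- K x)) - exp (-c) / lam"
      using eventually_gt_at_top[of 1]
    proof eventually_elim
      case (elim x)
      hence "exp (- K x) = exp (-c) * g x"
        by (simp add: K_def g_def exp_diff exp_add exp_minus field_simps)
      moreover have "1 + (x - lam) / (K x * lam) = (lam + (x - lam) / K x) / lam"
        using lam by (simp add: add_divide_distrib)
      ultimately show ?case by (simp add: mult_ac)
    qed
  qed
  finally show ?thesis .
qed

text \<open>Shifting \<open>K\<close> by \<open>x powr (-1/4)\<close> moves \<open>t\<close> by
  about \<open>a * x powr (3/4)\<close>. Half of this is kept as the distance from \<open>m\<close>;
  the rest absorbs rounding and the factor \<open>1 / q x\<close>, which costs only O(ln x). The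
  Chebyshev error is then of order \<open>ln x / sqrt x\<close>.\<close>

lemma
  fixes lam a c :: real
  assumes "lam > 0" "a > 0"
  defines "q \<equiv> \<lambda>x. exp (lam + (x - 1) * ln (1 - lam / x))"
  shows sample_size_below: "\<forall>\<^sub>F x in at_top.
      a * x * (ln x - ln (ln x) + c - x powr (-1/4)) / q x + a / 2 * x powr (3/4)
        \<le> a * x * (ln x - ln (ln x) + c) - 1"
    and sample_size_above: "\<forall>\<^sub>F x in at_top.
      a * x * (ln x - ln (ln x) + c) + a / 2 * x powr (3/4)
        \<le> a * x * (ln x - ln (ln x) + c + x powr (-1/4)) / q x"
    and sample_size_error:
      "(\<lambda>x. a * x * (ln x - ln (ln x) + c + x powr (-1/4)) / q x / (a / 2 * x powr (3/4))\<^sup>2)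
         \<in> O(\<lambda>x. ln (ln x) / ln x)"
  unfolding q_def using assms(1,2) by real_asymp+

text \<open>For \<open>v <= u\<close> the slope of \<open>exp (-x)\<close> is at most 1 in absolute
  value from \<open>v >= 0\<close> on; otherwise the left side is not positive. Being one-sided, the
  bound asks for a sign of \<open>v\<close> only.\<close>

lemma exp_minus_diff_le:
  fixes u v :: real
  assumes "v \<ge> 0"
  shows "exp (-v) - exp (-u) \<le> \<bar>u - v\<bar>"
proof (cases "v \<le> u")
  case True
  have "exp (-v) - exp (-u) = exp (-v) * (1 - exp (v - u))"
    by (simp add: algebra_simps flip: exp_add)
  also have "\<dots> \<le> 1 * (u - v)"
  proof (intro mult_mono)
    show "1 - exp (v - u) \<le> u - v" using exp_ge_add_one_self[of "v - u"] by linarith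
  qed (use True assms in auto)
  finally show ?thesis by simp
next
  case False
  hence "exp (-v) \<le> exp (-u)" by simp
  thus ?thesis by linarith
qed

section \<open>The rate for the distribution functions and the limit law\<close>

theorem theorem2:
  fixes lam :: real
    and M :: "nat \<Rightarrow> 'a measure"
    and X :: "nat \<Rightarrow> nat \<Rightarrow> 'a \<Rightarrow> nat"
  assumes lam: "lam > 0"
    and prob: "\<And>n. real n > lam \<Longrightarrow> prob_space (M n)"
    and indep: "\<And>n. real n > lam \<Longrightarrow>
          prob_space.indep_vars (M n) (\<lambda>_. count_space UNIV) (X n) UNIV"
    and law: "\<And>n k i. real n > lam \<Longrightarrow> i \<le> n \<Longrightarrow>
          measure (M n) {\<omega> \<in> space (M n). X n k \<omega> = i} = coupon_prob lam n i"
  shows "weak_conv_m (\<lambda>n. distr (M n) borel (norm_collect_time lam n (X n)))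
           (gumbel (- (exp lam / lam) * ln lam) (exp lam / lam)) \<and>
         (\<forall>d::real. (\<lambda>n. cdf (distr (M n) borel (norm_collect_time lam n (X n))) d
               - exp (- exp (- ((d - (- (exp lam / lam) * ln lam)) / (exp lam / lam)))))
             \<in> O(\<lambda>n. ln (ln (real n)) / ln (real n)))"
proof -
  define a where "a = exp lam / lam"
  have a: "a > 0" using lam by (simp add: a_def)
  define F where "F n = cdf (distr (M n) borel (norm_collect_time lam n (X n)))" for n
  define \<epsilon> where "\<epsilon> n = ln (ln (real n)) / ln (real n)" for n
  have rate: "(\<lambda>n. F n d - gumbel_cdf (- a * ln lam) a d) \<in> O(\<epsilon>)" for d
  proof -
    \<comment> \<open>\<open>d\<close> enters the threshold \<open>s\<close> for \<open>D\<close> as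
      a shift of \<open>ln n - ln (ln n)\<close> by \<open>c = d / a\<close>. The limiting exponent
      is \<open>A\<close>, its factor \<open>1 / lam\<close> coming from the location
      parameter.\<close>
    define c where "c = d / a"
    define A where "A = exp (-c) / lam"
    \<comment> \<open>\<open>K1\<close> gives a Poisson parameter below the threshold and the lower
      bound \<open>exp (- U x)\<close>; \<open>K2\<close> gives one above it and the upper bound
      \<open>exp (- L x)\<close>. The least distance from \<open>m\<close> is
      \<open>\<delta> x\<close>, and \<open>R\<close> bounds both Chebyshev errors.\<close>
    define K1 where "K1 x = ln x - ln (ln x) + c - x powr (-1/4)" for x
    define K2 where "K2 x = ln x - ln (ln x) + c + x powr (-1/4)" for x
    define q where "q x = exp (lam + (x - 1) * ln (1 - lam / x))" for x
    define s where "s x = a * x * (ln x - ln (ln x) + c)" for x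
    define \<delta> where "\<delta> x = a / 2 * x powr (3/4)" for x :: real
    define U where "U x = exp (- K1 x) * (1 + (x - lam) / (K1 x * lam)) * (1 + 2 * exp (- K1 x))" for x
    define L where "L x = exp (- K2 x) * (1 - exp (- (K2 x * lam))) * (x - lam) / (lam * (K2 x + 1))" for x
    define R where "R x = a * x * K2 x / q x / (\<delta> x)\<^sup>2" for x
    have A: "A \<ge> 0" using lam by (simp add: A_def)
    have limit: "gumbel_cdf (- a * ln lam) a d = exp (- A)"
    proof -
      have "- ((d - (- a * ln lam)) / a) = - c - ln lam" using a by (simp add: c_def field_simps)
      thus ?thesis using lam by (simp add: gumbel_cdf_def A_def exp_diff)
    qed
    \<comment> \<open>All conditions on \<open>n\<close> are collected for a real variable and then
      transferred along \<open>real\<close>.\<close>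
    have "\<forall>\<^sub>F x in at_top. lam < x \<and> 0 < x \<and> 0 < K1 x \<and> exp (- K1 x) \<le> 1 / 2 \<and> 0 < \<delta> x \<and> 0 \<le> s x
        \<and> a * x * K1 x / q x + \<delta> x \<le> s x - 1 \<and> s x + \<delta> x \<le> a * x * K2 x / q x"
    proof (intro eventually_conj)
      show "\<forall>\<^sub>F x in at_top. 0 < K1 x" unfolding K1_def by real_asymp
      show "\<forall>\<^sub>F x in at_top. exp (- K1 x) \<le> 1 / 2" unfolding K1_def by real_asymp
      show "\<forall>\<^sub>F x in at_top. 0 < \<delta> x" unfolding \<delta>_def using a by real_asymp
      show "\<forall>\<^sub>F x in at_top. 0 \<le> s x" unfolding s_def using a by real_asymp
      show "\<forall>\<^sub>F x in at_top. a * x * K1 x / q x + \<delta> x \<le> s x - 1"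
        unfolding K1_def q_def \<delta>_def s_def by (rule sample_size_below[OF lam a])
      show "\<forall>\<^sub>F x in at_top. s x + \<delta> x \<le> a * x * K2 x / q x"
        unfolding K2_def q_def \<delta>_def s_def by (rule sample_size_above[OF lam a])
    qed (rule eventually_gt_at_top)+
    from this[THEN eventually_compose_filterlim, OF filterlim_real_sequentially]
    have "\<forall>\<^sub>F n in sequentially. norm (F n d - exp (- A))
        \<le> 1 * norm (\<bar>L (real n) - A\<bar> + \<bar>U (real n) - A\<bar> + \<bar>R (real n)\<bar>)"
    proof eventually_elim
      case (elim n)
      define x where "x = real n"
      have x: "lam < x" "0 < x" "0 < K1 x" "exp (- K1 x) \<le> 1 / 2" "0 < \<delta> x" "0 \<le> s x"
        "a * x * K1 x / q x + \<delta> x \<le> s x - 1" "s x + \<delta> x \<le> a * x * K2 x / q x"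
        using elim by (auto simp: x_def)
      interpret prob_space "M n" using prob x by (simp add: x_def)
      note ind = indep[OF x(1)[unfolded x_def]]
      have law': "prob {\<omega> \<in> space (M n). X n k \<omega> = i} = coupon_prob lam n i"
        if "i \<in> {1..n}" for k i
        using law[of n i k] x(1) that by (simp add: x_def)
      note lamn = lam x(1)[unfolded x_def]
      define m where "m = nat \<lfloor>s x\<rfloor>"
      \<comment> \<open>Rounding down loses less than 1, which the \<open>- 1\<close> in the
        condition on \<open>K1\<close> pays for.\<close>
      have m: "real m \<le> s x" "s x - 1 < real m" using x(6) unfolding m_def by linarith+
      have "s x = exp lam / lam * real n * (ln (real n) - ln (ln (real n))) + d * real n"
        using a by (simp add: s_def a_def[symmetric] x_def c_def field_simps)
      hence Fm: "F n d = prob {\<omega> \<in> space (M n). \<forall>i\<in>{1..n}. \<exists>k<m. X n k \<omega> = i}"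
        unfolding F_def m_def by (intro cdf_norm_collect_time[OF ind lamn law']) (use x(6) in auto)
      have t: "K / coupon_prob lam n n = a * x * K / q x" for K
        unfolding a_def x_def q_def by (rule coupon_prob_last[OF lamn])
      define t1 t2 where "t1 = a * x * K1 x / q x" and "t2 = a * x * K2 x / q x"
      have K12: "K1 x \<le> K2 x" by (simp add: K1_def K2_def)
      have K2: "K2 x > 0" using x(3) K12 by linarith
      have q: "q x > 0" by (simp add: q_def)
      have t12: "0 \<le> t1" "t1 \<le> t2"
        unfolding t1_def t2_def using a x q K12 by (auto intro!: divide_right_mono mult_left_mono)
      have t1m: "\<delta> x \<le> real m - t1" and t2m: "\<delta> x \<le> t2 - real m"
        using x(7,8) m unfolding t1_def t2_def by linarith+
      \<comment> \<open>Since \<open>t1 <= t2\<close> and both distances are at least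
        \<open>\<delta> x\<close>, a single quotient covers both errors.\<close>
      have "t1 / (real m - t1)\<^sup>2 \<le> t2 / (\<delta> x)\<^sup>2" "t2 / (t2 - real m)\<^sup>2 \<le> t2 / (\<delta> x)\<^sup>2"
        using t12 t1m t2m x(5) by (auto intro!: frac_le power_mono)
      hence err: "t1 / (real m - t1)\<^sup>2 \<le> R x" "t2 / (t2 - real m)\<^sup>2 \<le> R x"
        by (simp_all add: R_def t2_def)
      have "exp (- U x) \<le> F n d + t1 / (real m - t1)\<^sup>2"
        unfolding Fm U_def x_def
        by (rule all_drawn_ge[OF ind lamn law']) (use x t t1m in \<open>auto simp: t1_def x_def\<close>)
      hence lower: "exp (- A) - F n d \<le> \<bar>U x - A\<bar> + R x"
        using err exp_minus_diff_le[OF A, of "U x"] by linarith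
      have "F n d \<le> exp (- L x) + t2 / (t2 - real m)\<^sup>2"
        unfolding Fm L_def x_def
        by (rule all_drawn_le[OF ind lamn law']) (use x K2 t t2m in \<open>auto simp: t2_def x_def\<close>)
      \<comment> \<open>In the upper bound \<open>L x\<close> is the argument of
        \<open>exp_minus_diff_le\<close> whose sign matters; in the lower bound it was
        \<open>A\<close>.\<close>
      moreover have "L x \<ge> 0" using x(1) lam K2 by (simp add: L_def)
      ultimately have upper: "F n d - exp (- A) \<le> \<bar>A - L x\<bar> + R x"
        using err exp_minus_diff_le[of "L x" A] by linarith
      show ?case using lower upper by (simp add: x_def abs_if split: if_splits)
    qed
    hence bound: "(\<lambda>n. F n d - exp (- A))
        \<in> O(\<lambda>n. \<bar>L (real n) - A\<bar> + \<bar>U (real n) - A\<bar> + \<bar>R (real n)\<bar>)"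
      by (rule bigoI)
    have "(\<lambda>x. \<bar>L x - A\<bar> + \<bar>U x - A\<bar> + \<bar>R x\<bar>) \<in> O(\<lambda>x. ln (ln x) / ln x)"
    proof (intro sum_in_bigo)
      show "(\<lambda>x. \<bar>L x - A\<bar>) \<in> O(\<lambda>x. ln (ln x) / ln x)"
        using gumbel_exponent_lower_asymp[OF lam, of c] by (simp add: L_def K2_def A_def)
      show "(\<lambda>x. \<bar>U x - A\<bar>) \<in> O(\<lambda>x. ln (ln x) / ln x)"
        using gumbel_exponent_upper_asymp[OF lam, of c] by (simp add: U_def K1_def A_def)
      have "(\<lambda>x. R x) \<in> O(\<lambda>x. ln (ln x) / ln x)"
        unfolding R_def K2_def q_def \<delta>_def by (rule sample_size_error[OF lam a])
      thus "(\<lambda>x. \<bar>R x\<bar>) \<in> O(\<lambda>x. ln (ln x) / ln x)" by simp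
    qed
    hence "(\<lambda>n. \<bar>L (real n) - A\<bar> + \<bar>U (real n) - A\<bar> + \<bar>R (real n)\<bar>) \<in> O(\<epsilon>)"
      unfolding \<epsilon>_def by (rule landau_o.big.compose) (rule filterlim_real_sequentially)
    with bound show ?thesis unfolding limit by (rule landau_o.big_trans)
  qed
  \<comment> \<open>The rate tends to 0, so the distribution functions converge at every point, in
    particular at the continuity points required for weak convergence.\<close>
  have "(\<lambda>n. F n d) \<longlonglongrightarrow> gumbel_cdf (- a * ln lam) a d" for d
  proof -
    have "\<epsilon> \<longlonglongrightarrow> 0" unfolding \<epsilon>_def by real_asymp
    hence "\<epsilon> \<in> o(\<lambda>_. 1)" by (intro smalloI_tendsto) auto
    with rate[of d] have "(\<lambda>n. F n d - gumbel_cdf (- a * ln lam) a d) \<in> o(\<lambda>_. 1)"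
      by (rule landau_o.big_small_trans)
    hence "(\<lambda>n. F n d - gumbel_cdf (- a * ln lam) a d) \<longlonglongrightarrow> 0"
      by (auto dest: smalloD_tendsto)
    thus ?thesis by (simp add: LIM_zero_iff)
  qed
  hence "weak_conv_m (\<lambda>n. distr (M n) borel (norm_collect_time lam n (X n))) (gumbel (- a * ln lam) a)"
    unfolding weak_conv_m_def weak_conv_def cdf_gumbel[OF a] F_def by blast
  thus ?thesis
    using rate unfolding F_def \<epsilon>_def gumbel_cdf_def a_def by blast
qed

end
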